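(* For any self-similar set $F\subset\mathbb{R}^d$ satisfying OSC, the central open set $V_c$ is a strong feasible set for $F$ satisfying the projection condition, i.e. (with $O=V_c$) $S_iV_c\subset\overline{\pi_F^{-1}(S_iF)}$ for $i=1,\dots,N$.
   Context: $N\ge2$, $S_1,\dots,S_N:\mathbb{R}^d\to\mathbb{R}^d$ are contracting similarities with ratios $r_i\in(0,1)$ (an IFS), and the self-similar set $F$ generated by the IFS is the unique nonempty compact set with $F=\bigcup_{i=1}^N S_iF$. Open set condition (OSC): there exists a nonempty and bounded open set $O\subset\mathbb{R}^d$ such that, for all $i\neq j$, $S_iO\subset O$ and $S_iO\cap S_jO=\emptyset$. Any such set $O$ (nonempty, bounded, open, with these relations) is called a feasible open set for $F$ (or for the IFS); if additionally $O\cap F\neq\emptyset$, then $O$ is called a strong feasible open set for $F$. Central open set: let $\mathcal{H}:=\{h=S_\sigma^{-1}S_\omega:\sigma,\omega \text{ nonempty finite words over }\{1,\dots,N\},\ \sigma_1\ne\omega_1\}$ be the family of all neighbor maps of the IFS, where $\sigma_1,\omega_1$ are the first letters of $\sigma,\omega$ and $S_\sigma=S_{\sigma_1}\circ\dots\circ S_{\sigma_n}$ for $\sigma=\sigma_1\cdots\sigma_n$. Let $H:=\bigcup\{h(F):h\in\mathcal{H}\}$ be the union of all neighbors of $F$. Then $V_c:=\{x\in\mathbb{R}^d:d(x,F)<d(x,H)\}$, where $d(x,A)=\inf_{a\in A}|x-a|$. Projection condition for a feasible set $O$: $S_iO\subset\overline{\pi_F^{-1}(S_iF)}$ for $i=1,\dots,N$.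 Here $\pi_F$ is the metric projection onto $F$, defined on the set $U(F)$ of points $x\in\mathbb{R}^d$ which have a unique nearest point in $F$; $\pi_F^{-1}(S_iF)=\{x\in U(F):\pi_F(x)\in S_iF\}$, and the bar denotes closure.
   Formalization: Boundedness of V_c (part of "feasible") is claimed only when F affinely spans R^d; otherwise V_c is unbounded, e.g. F=[0,1]×{0} in the plane with maps x/2 and x/2+(1/2,0). All other properties, including the projection condition, are proved for every F with OSC. *)

theory Defs
  imports "HOL-Analysis.Analysis"
begin

definition contracting_similarity :: "real \<Rightarrow> (real ^ 'd \<Rightarrow> real ^ 'd) \<Rightarrow> bool" where
  "contracting_similarity r f \<longleftrightarrow>
     0 < r \<and> r < 1 \<and> (\<forall>x y. dist (f x) (f y) = r * dist x y)"

text \<open>An IFS is a family \<open>S 1, \<dots>, S N\<close>; the values of \<open>S\<close> and \<open>r\<close> outside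
  \<open>{1..N}\<close> are irrelevant.\<close>

definition ifs :: "nat \<Rightarrow> (nat \<Rightarrow> real) \<Rightarrow> (nat \<Rightarrow> real ^ 'd \<Rightarrow> real ^ 'd) \<Rightarrow> bool" where
  "ifs N r S \<longleftrightarrow> 2 \<le> N \<and> (\<forall>i\<in>{1..N}. contracting_similarity (r i) (S i))"

definition self_similar_set :: "nat \<Rightarrow> (nat \<Rightarrow> real ^ 'd \<Rightarrow> real ^ 'd) \<Rightarrow> (real ^ 'd) set \<Rightarrow> bool" where
  "self_similar_set N S F \<longleftrightarrow> F \<noteq> {} \<and> compact F \<and> F = (\<Union>i\<in>{1..N}. S i ` F)"

definition open_set_relations :: "nat \<Rightarrow> (nat \<Rightarrow> real ^ 'd \<Rightarrow> real ^ 'd) \<Rightarrow> (real ^ 'd) set \<Rightarrow> bool" where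
  "open_set_relations N S V \<longleftrightarrow>
     V \<noteq> {} \<and> open V \<and>
     (\<forall>i\<in>{1..N}. S i ` V \<subseteq> V) \<and>
     (\<forall>i\<in>{1..N}. \<forall>j\<in>{1..N}. i \<noteq> j \<longrightarrow> S i ` V \<inter> S j ` V = {})"

definition feasible_open_set :: "nat \<Rightarrow> (nat \<Rightarrow> real ^ 'd \<Rightarrow> real ^ 'd) \<Rightarrow> (real ^ 'd) set \<Rightarrow> bool" where
  "feasible_open_set N S V \<longleftrightarrow> bounded V \<and> open_set_relations N S V"

definition open_set_condition :: "nat \<Rightarrow> (nat \<Rightarrow> real ^ 'd \<Rightarrow> real ^ 'd) \<Rightarrow> bool" where
  "open_set_condition N S \<longleftrightarrow> (\<exists>V. feasible_open_set N S V)"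

definition strong_feasible_open_set ::
  "nat \<Rightarrow> (nat \<Rightarrow> real ^ 'd \<Rightarrow> real ^ 'd) \<Rightarrow> (real ^ 'd) set \<Rightarrow> (real ^ 'd) set \<Rightarrow> bool" where
  "strong_feasible_open_set N S F V \<longleftrightarrow> feasible_open_set N S V \<and> V \<inter> F \<noteq> {}"

definition words :: "nat \<Rightarrow> nat list set" where
  "words N = {w. w \<noteq> [] \<and> set w \<subseteq> {1..N}}"

definition word_map :: "(nat \<Rightarrow> real ^ 'd \<Rightarrow> real ^ 'd) \<Rightarrow> nat list \<Rightarrow> real ^ 'd \<Rightarrow> real ^ 'd" where
  "word_map S w = foldr (\<lambda>i f. S i \<circ> f) w id"

definition neighbor_maps :: "nat \<Rightarrow> (nat \<Rightarrow> real ^ 'd \<Rightarrow> real ^ 'd) \<Rightarrow> (real ^ 'd \<Rightarrow> real ^ 'd) set" where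
  "neighbor_maps N S =
     {inv (word_map S \<sigma>) \<circ> word_map S \<omega> | \<sigma> \<omega>. \<sigma> \<in> words N \<and> \<omega> \<in> words N \<and> hd \<sigma> \<noteq> hd \<omega>}"

definition neighbor_union :: "nat \<Rightarrow> (nat \<Rightarrow> real ^ 'd \<Rightarrow> real ^ 'd) \<Rightarrow> (real ^ 'd) set \<Rightarrow> (real ^ 'd) set" where
  "neighbor_union N S F = (\<Union>h\<in>neighbor_maps N S. h ` F)"

definition central_open_set :: "nat \<Rightarrow> (nat \<Rightarrow> real ^ 'd \<Rightarrow> real ^ 'd) \<Rightarrow> (real ^ 'd) set \<Rightarrow> (real ^ 'd) set" where
  "central_open_set N S F = {x. infdist x F < infdist x (neighbor_union N S F)}"

definition unique_nearest :: "(real ^ 'd) set \<Rightarrow> (real ^ 'd) set" where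
  "unique_nearest F = {x. \<exists>!p. p \<in> F \<and> (\<forall>y\<in>F. dist x p \<le> dist x y)}"

text \<open>The metric projection is \<open>closest_point F\<close> restricted to \<open>unique_nearest F\<close>; elsewhere
  \<open>closest_point\<close> is an arbitrary choice, so the domain has to be imposed explicitly.\<close>

definition metric_proj_preimage :: "(real ^ 'd) set \<Rightarrow> (real ^ 'd) set \<Rightarrow> (real ^ 'd) set" where
  "metric_proj_preimage F A = {x \<in> unique_nearest F. closest_point F x \<in> A}"

definition projection_condition ::
  "nat \<Rightarrow> (nat \<Rightarrow> real ^ 'd \<Rightarrow> real ^ 'd) \<Rightarrow> (real ^ 'd) set \<Rightarrow> (real ^ 'd) set \<Rightarrow> bool" where
  "projection_condition N S F V \<longleftrightarrow>
     (\<forall>i\<in>{1..N}. S i ` V \<subseteq> closure (metric_proj_preimage F (S i ` F)))"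

text \<open>Boundedness is kept apart in \<open>open_set_relations\<close> because the central open set is unbounded
  when \<open>F\<close> lies in a hyperplane: membership in it then depends only on the orthogonal projection
  to the affine hull of \<open>F\<close>. For \<open>F = [0,1] \<times> {0}\<close> in the plane, generated by \<open>x \<mapsto> x/2\<close> and
  \<open>x \<mapsto> x/2 + (1/2,0)\<close>, it contains the whole strip \<open>(0,1) \<times> \<real>\<close>.\<close>

end

theory Submission
  imports Defs "HOL-Library.Sublist"
begin

text \<open>
  Write \<open>H\<close> for the union of all neighbours of \<open>F\<close> and \<open>V\<close> for the central open set. Appending a
  letter to \<open>\<sigma>\<close> in \<open>S\<^sub>\<sigma>\<inverse> S\<^sub>\<omega>\<close> gives another neighbour map, so \<open>H\<close> is invariant under every \<open>S\<^sub>i\<inverse>\<close>,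
  while \<open>F\<close> is invariant under every \<open>S\<^sub>i\<close>. Applying \<open>S\<^sub>i\<close> to a point nearer to \<open>F\<close> than to \<open>H\<close>
  therefore preserves this property (\<open>V_forward_invariant\<close>). Since \<open>H\<close> contains \<open>S\<^sub>i\<inverse> S\<^sub>j F\<close>, a point of
  \<open>S\<^sub>i V\<close> is strictly nearer to \<open>S\<^sub>i F\<close> than to \<open>S\<^sub>j F\<close> (\<open>V_image_nearest_piece\<close>). This makes the images
  \<open>S\<^sub>i V\<close> disjoint, and it puts all nearest points of such a point into \<open>S\<^sub>i F\<close>; moving slightly
  towards one of them makes it unique, which is the projection condition.

  The open set condition enters only in showing that \<open>V\<close> meets \<open>F\<close>. The argument is
  Schief's: count the cylinders of size comparable to that of \<open>S\<^sub>\<sigma> F\<close> that come close to it. The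
  disjoint images of the given open set bound this number uniformly in \<open>\<sigma>\<close>
  (\<open>nearby_card_bounded\<close>). Prepending \<open>\<tau>\<close> to \<open>\<sigma>\<close> carries close cylinders to close
  cylinders, so if the number for \<open>\<sigma>\<close> is maximal, no new ones appear around \<open>S\<^sub>\<tau> S\<^sub>\<sigma> F\<close>. Hence all pieces
  \<open>S\<^sub>\<omega> F\<close> whose first letter differs from that of \<open>\<tau>\<close> stay away from it. Scaling back by
  \<open>S\<^sub>\<tau>\<inverse>\<close>, the cylinder \<open>S\<^sub>\<sigma> F\<close> has positive distance from \<open>H\<close> (\<open>cylinder_away_from_neighbors\<close>).

  For boundedness, points of \<open>V\<close> escaping to infinity in direction \<open>u\<close> force \<open>H\<close> into a half-space
  on which \<open>\<lambda>x. u \<bullet> x\<close> is bounded above (\<open>V_unbounded_H_half_space\<close>). But \<open>H\<close> contains, for each word \<open>\<sigma>\<close> and each point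
  \<open>z\<close> of a piece \<open>S\<^sub>j F\<close> with \<open>j\<close> not the first letter of \<open>\<sigma>\<close>, the whole backward orbit \<open>S\<^sub>\<sigma>\<^sup>-\<^sup>n z\<close> for \<open>n \<ge> 1\<close>. It expands
  away from the fixed point \<open>p\<close> of \<open>S\<^sub>\<sigma>\<close>, and infinitely often in almost the direction \<open>z - p\<close>, because
  isometries of compact spheres are recurrent. So \<open>u \<bullet> z \<le> u \<bullet> p\<close>. Fixed points of words beginning with \<open>i\<close>
  are dense in \<open>S\<^sub>i F\<close>; exchanging \<open>i\<close> and \<open>j\<close> gives equality, so \<open>F\<close> lies in a hyperplane
  (\<open>H_half_space_F_hyperplane\<close>).
\<close>

section \<open>Similarities of Euclidean space\<close>

lemma similarity_decomposition:
  fixes f :: "'a::euclidean_space \<Rightarrow> 'a"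
  assumes "0 < r" and sim: "\<And>x y. dist (f x) (f y) = r * dist x y"
  obtains R where "orthogonal_transformation R" "\<And>x. f x = f p + r *\<^sub>R R (x - p)"
proof
  let ?R = "\<lambda>v. (1 / r) *\<^sub>R (f (p + v) - f p)"
  have "dist (?R v) (?R w) = dist v w" for v w
  proof -
    have "?R v - ?R w = (1 / r) *\<^sub>R (f (p + v) - f (p + w))"
      by (simp add: algebra_simps)
    then have "dist (?R v) (?R w) = (1 / r) * dist (f (p + v)) (f (p + w))"
      using \<open>0 < r\<close> by (simp add: dist_norm)
    also have "\<dots> = dist v w"
      using \<open>0 < r\<close> by (simp add: sim)
    finally show ?thesis .
  qed
  then show "orthogonal_transformation ?R"
    unfolding orthogonal_transformation_isometry by simp
  show "f x = f p + r *\<^sub>R ?R (x - p)" for x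
    using \<open>0 < r\<close> by simp
qed

lemma similarity_bij:
  fixes f :: "'a::euclidean_space \<Rightarrow> 'a"
  assumes "0 < r" and sim: "\<And>x y. dist (f x) (f y) = r * dist x y"
  shows "bij f"
proof (rule bijI)
  show "inj f"
    by (metis assms(1) dist_eq_0_iff injI less_irrefl mult_eq_0_iff sim)
  obtain R where R: "orthogonal_transformation R" "\<And>x. f x = f 0 + r *\<^sub>R R (x - 0)"
    using similarity_decomposition[OF assms, where p = 0] by blast
  show "surj f"
  proof (rule surjI)
    fix y
    have "R (inv R ((1 / r) *\<^sub>R (y - f 0))) = (1 / r) *\<^sub>R (y - f 0)"
      by (rule surj_f_inv_f[OF orthogonal_transformation_surj[OF R(1)]])
    then show "f (inv R ((1 / r) *\<^sub>R (y - f 0))) = y"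
      using \<open>0 < r\<close> by (simp add: R(2)[of "inv R _"])
  qed
qed

text \<open>
  Two members of a convergent subsequence of the orbit, with indices \<open>k + n\<close> and \<open>k\<close>, are close;
  cancelling the isometry \<open>T\<^sup>k\<close> brings \<open>T\<^sup>n v\<close> close to \<open>v\<close>.
\<close>

lemma isometry_bounded_orbit_recurrent:
  fixes T :: "'a::heine_borel \<Rightarrow> 'a"
  assumes iso: "\<And>x y. dist (T x) (T y) = dist x y"
    and bdd: "bounded (range (\<lambda>n. (T ^^ n) v))"
    and "0 < e"
  shows "\<exists>n\<ge>m. dist ((T ^^ n) v) v < e"
proof -
  have iso_pow: "dist ((T ^^ n) x) ((T ^^ n) y) = dist x y" for n x y
    by (induction n) (simp_all add: iso)
  obtain l s where s: "strict_mono (s :: nat \<Rightarrow> nat)" "((\<lambda>n. (T ^^ n) v) \<circ> s) \<longlonglongrightarrow> l"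
    using bounded_imp_convergent_subsequence[OF bdd] by blast
  then have "Cauchy ((\<lambda>n. (T ^^ n) v) \<circ> s)"
    using LIMSEQ_imp_Cauchy by blast
  then obtain K where K: "\<And>k. k \<ge> K \<Longrightarrow> dist ((T ^^ s k) v) ((T ^^ s K) v) < e"
    using \<open>0 < e\<close> unfolding Cauchy_def comp_def by blast
  have le: "s K + m \<le> s (K + m)"
    by (induction m) (auto intro: le_trans[OF _ Suc_leI] strict_monoD[OF s(1)])
  then have "(T ^^ s (K + m)) v = (T ^^ s K) ((T ^^ (s (K + m) - s K)) v)"
    by (metis add_leD1 comp_apply funpow_add le_add_diff_inverse)
  then have "dist ((T ^^ (s (K + m) - s K)) v) v < e"
    using K[of "K + m"] iso_pow by simp
  then show ?thesis
    using le by (intro exI[of _ "s (K + m) - s K"]) auto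
qed

text \<open>
  Backward iterates of \<open>z\<close> have the form \<open>p + r\<^sup>-\<^sup>n T\<^sup>n (z - p)\<close> with \<open>T\<close> orthogonal. An upper bound for
  \<open>u\<close> along them gives \<open>u \<bullet> T\<^sup>n (z - p) \<le> O(r\<^sup>n)\<close>, and \<open>T\<^sup>n (z - p)\<close> returns arbitrarily close to \<open>z - p\<close>
  for arbitrarily large \<open>n\<close>.
\<close>

lemma backward_orbit_half_space:
  fixes f :: "'a::euclidean_space \<Rightarrow> 'a"
  assumes "0 < r" "r < 1" and sim: "\<And>x y. dist (f x) (f y) = r * dist x y"
    and fixp: "f p = p"
    and half: "\<And>n w. 1 \<le> n \<Longrightarrow> (f ^^ n) w = z \<Longrightarrow> u \<bullet> w \<le> c"
  shows "u \<bullet> z \<le> u \<bullet> p"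
proof -
  obtain R where R: "orthogonal_transformation R" "\<And>x. f x = p + r *\<^sub>R R (x - p)"
    using similarity_decomposition[OF \<open>0 < r\<close> sim, where p = p] fixp by metis
  define T where "T = inv R"
  have T: "orthogonal_transformation T"
    unfolding T_def by (rule orthogonal_transformation_inv[OF R(1)])
  have RT: "R (T x) = x" for x
    unfolding T_def by (meson R(1) orthogonal_transformation_surj surj_f_inv_f)
  have iso: "dist (T x) (T y) = dist x y" for x y
    using T unfolding orthogonal_transformation_isometry by blast
  define v where "v = z - p"
  have norm_T: "norm ((T ^^ n) v) = norm v" for n
    by (induction n) (simp_all add: orthogonal_transformation_norm[OF T])
  define w where "w n = p + (1 / r) ^ n *\<^sub>R (T ^^ n) v" for n
  have "f (w (Suc n)) = w n" for n
    using \<open>0 < r\<close> orthogonal_transformation_linear[OF R(1)]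
    by (simp add: w_def R(2) RT linear_scale)
  then have orbit: "(f ^^ n) (w n) = z" for n
    by (induction n) (simp_all add: funpow_swap1 w_def v_def del: funpow.simps(2) add: funpow_Suc_right)
  have bound: "u \<bullet> (T ^^ n) v \<le> r ^ n * \<bar>c - u \<bullet> p\<bar>" if "1 \<le> n" for n
  proof -
    have "(1 / r) ^ n * (u \<bullet> (T ^^ n) v) \<le> \<bar>c - u \<bullet> p\<bar>"
      using half[OF that orbit] by (simp add: w_def inner_add_right)
    then show ?thesis
      using \<open>0 < r\<close> by (simp add: power_one_over field_simps)
  qed
  have "u \<bullet> v \<le> (1 + norm u) * e" if "0 < e" for e
  proof -
    have "(\<lambda>n. r ^ n * \<bar>c - u \<bullet> p\<bar>) \<longlonglongrightarrow> 0 * \<bar>c - u \<bullet> p\<bar>"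
      using \<open>0 < r\<close> \<open>r < 1\<close> by (intro tendsto_intros LIMSEQ_power_zero) auto
    then have "\<forall>\<^sub>F n in sequentially. r ^ n * \<bar>c - u \<bullet> p\<bar> < e"
      using \<open>0 < e\<close> by (auto intro: order_tendstoD)
    then obtain m where m: "\<And>n. n \<ge> m \<Longrightarrow> r ^ n * \<bar>c - u \<bullet> p\<bar> < e"
      by (auto simp: eventually_sequentially)
    have "bounded (range (\<lambda>n. (T ^^ n) v))"
      by (rule boundedI[of _ "norm v"]) (auto simp: norm_T)
    from isometry_bounded_orbit_recurrent[OF iso this \<open>0 < e\<close>, of "Suc m"]
    obtain n where n: "n \<ge> Suc m" "dist ((T ^^ n) v) v < e"
      by blast
    have "u \<bullet> v = u \<bullet> (T ^^ n) v + u \<bullet> (v - (T ^^ n) v)"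
      by (simp add: inner_diff_right)
    also have "u \<bullet> (v - (T ^^ n) v) \<le> norm u * norm (v - (T ^^ n) v)"
      by (rule norm_cauchy_schwarz)
    also have "\<dots> \<le> norm u * e"
      using n(2) by (intro mult_left_mono) (auto simp: dist_norm norm_minus_commute)
    finally show ?thesis
      using bound[of n] m[of n] n(1) by (simp add: algebra_simps)
  qed
  then have "u \<bullet> v \<le> 0 + e" if "0 < e" for e
  proof -
    have pos: "0 < 1 + norm u"
      by (simp add: add_pos_nonneg)
    from that pos have "u \<bullet> v \<le> (1 + norm u) * (e / (1 + norm u))"
      by (intro \<open>\<And>e. 0 < e \<Longrightarrow> u \<bullet> v \<le> (1 + norm u) * e\<close> divide_pos_pos)
    with pos show ?thesis
      by simp
  qed
  then have "u \<bullet> v \<le> 0"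
    by (rule field_le_epsilon)
  then show ?thesis
    by (simp add: v_def inner_diff_right)
qed

section \<open>Nearest points\<close>

text \<open>
  Every point of the half-open segment from \<open>z\<close> to a nearest point \<open>p\<close>, excluding \<open>z\<close>, has \<open>p\<close> as
  its only nearest point.
\<close>

lemma nearest_point_in_closure_metric_proj_preimage:
  assumes "p \<in> F" "p \<in> A" and near: "\<And>y. y \<in> F \<Longrightarrow> dist z p \<le> dist z y"
  shows "z \<in> closure (metric_proj_preimage F A)"
proof -
  define g where "g t = z + t *\<^sub>R (p - z)" for t :: real
  have strict: "dist (g t) p < dist (g t) y" if t: "0 < t" "t \<le> 1" and y: "y \<in> F" "y \<noteq> p" for t y
  proof -
    define a where "a = z - p"
    define w where "w = y - p"
    have eqs: "g t - p = (1 - t) *\<^sub>R a" "g t - y = (1 - t) *\<^sub>R a - w" "z - y = a - w"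
      by (simp_all add: g_def a_def w_def algebra_simps)
    \<comment> \<open>Minimality of \<open>p\<close> says \<open>2 (a \<bullet> w) \<le> w \<bullet> w\<close>; shrinking \<open>a\<close> by \<open>1 - t\<close> leaves a surplus \<open>t (w \<bullet> w)\<close>.\<close>
    have "(norm a)\<^sup>2 \<le> (norm (a - w))\<^sup>2"
      using near[OF y(1)] by (intro power_mono) (auto simp: dist_norm eqs a_def[symmetric])
    then have "2 * (a \<bullet> w) \<le> w \<bullet> w"
      by (simp add: power2_norm_eq_inner algebra_simps inner_commute)
    then have "(1 - t) * (2 * (a \<bullet> w)) \<le> (1 - t) * (w \<bullet> w)"
      using t by (intro mult_left_mono) auto
    moreover have "0 < t * (w \<bullet> w)"
      using t y(2) by (simp add: w_def)
    moreover have "(norm ((1 - t) *\<^sub>R a - w))\<^sup>2 = (norm ((1 - t) *\<^sub>R a))\<^sup>2 - (1 - t) * (2 * (a \<bullet> w)) + w \<bullet> w"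
      unfolding power2_norm_eq_inner
      by (simp add: inner_diff_left inner_diff_right inner_commute)
    ultimately have "(norm ((1 - t) *\<^sub>R a))\<^sup>2 < (norm ((1 - t) *\<^sub>R a - w))\<^sup>2"
      by (simp add: algebra_simps)
    then have "norm ((1 - t) *\<^sub>R a) < norm ((1 - t) *\<^sub>R a - w)"
      by (rule power2_less_imp_less) simp
    then show ?thesis
      by (simp add: dist_norm eqs)
  qed
  have proj: "g t \<in> metric_proj_preimage F A" if t: "0 < t" "t \<le> 1" for t
  proof -
    have iff: "q \<in> F \<and> (\<forall>y\<in>F. dist (g t) q \<le> dist (g t) y) \<longleftrightarrow> q = p" for q
      using strict[OF t] \<open>p \<in> F\<close> by (metis less_le_not_le order_refl less_imp_le)
    then show ?thesis
      using \<open>p \<in> A\<close>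
      by (simp add: metric_proj_preimage_def unique_nearest_def closest_point_def)
  qed
  have "(\<lambda>n. g (1 / real (Suc n))) \<longlonglongrightarrow> z + 0 *\<^sub>R (p - z)"
    unfolding g_def by (intro tendsto_intros LIMSEQ_Suc[OF lim_1_over_n])
  moreover have "g (1 / real (Suc n)) \<in> metric_proj_preimage F A" for n
    by (rule proj) auto
  ultimately show ?thesis
    unfolding closure_sequential by (intro exI[of _ "\<lambda>n. g (1 / real (Suc n))"]) auto
qed

lemma infdist_greatest:
  assumes "A \<noteq> {}" "\<And>a. a \<in> A \<Longrightarrow> c \<le> dist x a"
  shows "c \<le> infdist x A"
  using assms by (auto simp: infdist_def intro: cINF_greatest)

text \<open>
  Finitely many balls of radius \<open>\<delta> / 2\<close> cover \<open>B\<close>, and each of them contains at most one point of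
  a \<open>\<delta>\<close>-separated family.
\<close>

lemma bounded_separated_card_le:
  fixes B :: "'a::heine_borel set"
  assumes "bounded B" "0 < \<delta>"
  shows "\<exists>M. \<forall>(I :: 'i set) f. f ` I \<subseteq> B \<and> (\<forall>i\<in>I. \<forall>j\<in>I. i \<noteq> j \<longrightarrow> \<delta> \<le> dist (f i) (f j))
    \<longrightarrow> finite I \<and> card I \<le> M"
proof -
  have "compact (closure B)"
    using assms(1) by (simp add: compact_closure)
  then have "\<exists>K. finite K \<and> closure B \<subseteq> (\<Union>k\<in>K. ball k (\<delta> / 2))"
    using \<open>0 < \<delta>\<close> unfolding compact_eq_totally_bounded by (metis half_gt_zero)
  then obtain K where K: "finite K" "B \<subseteq> (\<Union>k\<in>K. ball k (\<delta> / 2))"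
    using closure_subset by (metis subset_trans)
  show ?thesis
  proof (intro exI[of _ "card K"] allI impI, elim conjE)
    fix I :: "'i set" and f
    assume I: "f ` I \<subseteq> B" and sep: "\<forall>i\<in>I. \<forall>j\<in>I. i \<noteq> j \<longrightarrow> \<delta> \<le> dist (f i) (f j)"
    have "\<exists>k\<in>K. dist k (f i) < \<delta> / 2" if "i \<in> I" for i
      using K(2) I that unfolding subset_iff by (metis UN_E imageI mem_ball)
    then obtain k where k: "\<And>i. i \<in> I \<Longrightarrow> k i \<in> K \<and> dist (k i) (f i) < \<delta> / 2"
      by metis
    have "inj_on k I"
    proof (rule inj_onI, rule ccontr)
      fix i j assume ij: "i \<in> I" "j \<in> I" "k i = k j" "i \<noteq> j"
      have "dist (f i) (f j) \<le> dist (k i) (f i) + dist (k i) (f j)"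
        by (metis dist_commute dist_triangle)
      then show False
        using sep ij k[OF ij(1)] k[OF ij(2)] by fastforce
    qed
    then show "finite I \<and> card I \<le> card K"
      using k K(1) by (meson card_inj_on_le image_subsetI inj_on_finite)
  qed
qed

section \<open>Words and cylinder sets\<close>

lemma word_map_Nil [simp]: "word_map S [] x = x"
  by (simp add: word_map_def)

lemma word_map_Cons [simp]: "word_map S (i # w) x = S i (word_map S w x)"
  by (simp add: word_map_def)

lemma word_map_append [simp]: "word_map S (v @ w) x = word_map S v (word_map S w x)"
  by (induction v) simp_all

lemma word_map_concat_replicate: "word_map S (concat (replicate n w)) x = (word_map S w ^^ n) x"
  by (induction n) simp_all

definition word_ratio :: "(nat \<Rightarrow> real) \<Rightarrow> nat list \<Rightarrow> real" where
  "word_ratio r w = prod_list (map r w)"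

lemma word_ratio_simps [simp]:
  "word_ratio r [] = 1"
  "word_ratio r (i # w) = r i * word_ratio r w"
  "word_ratio r (v @ w) = word_ratio r v * word_ratio r w"
  by (simp_all add: word_ratio_def)

locale self_similar_ifs =
  fixes N :: nat and r :: "nat \<Rightarrow> real" and S :: "nat \<Rightarrow> real ^ 'd \<Rightarrow> real ^ 'd"
    and F :: "(real ^ 'd) set"
  assumes ifs: "ifs N r S" and self_similar: "self_similar_set N S F"
begin

abbreviation "letters \<equiv> {1..N}"
abbreviation "H \<equiv> neighbor_union N S F"
abbreviation "V \<equiv> central_open_set N S F"

lemma ratio: "i \<in> letters \<Longrightarrow> 0 < r i" "i \<in> letters \<Longrightarrow> r i < 1"
  and S_dist: "i \<in> letters \<Longrightarrow> dist (S i x) (S i y) = r i * dist x y"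
  using ifs by (auto simp: ifs_def contracting_similarity_def)

lemma two_letters: "1 \<in> letters" "2 \<in> letters"
  using ifs by (auto simp: ifs_def)

lemma other_letter:
  obtains j where "j \<in> letters" "j \<noteq> i"
  using two_letters by (metis one_eq_numeral_iff semiring_norm(83))

lemma F_nonempty: "F \<noteq> {}" and F_compact: "compact F" and F_union: "F = (\<Union>i\<in>letters. S i ` F)"
  using self_similar unfolding self_similar_set_def by blast+

lemma S_in_F: "i \<in> letters \<Longrightarrow> x \<in> F \<Longrightarrow> S i x \<in> F"
  by (subst F_union) blast

lemma F_cases:
  assumes "x \<in> F"
  obtains i y where "i \<in> letters" "y \<in> F" "x = S i y"
  using assms by (subst (asm) F_union) blast

lemma word_ratio_pos: "set w \<subseteq> letters \<Longrightarrow> 0 < word_ratio r w"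
  by (induction w) (auto simp: ratio simp del: atLeastAtMost_iff)

lemma word_ratio_le_1: "set w \<subseteq> letters \<Longrightarrow> word_ratio r w \<le> 1"
proof (induction w)
  case (Cons i w)
  then have "i \<in> letters" "set w \<subseteq> letters"
    by simp_all
  then show ?case
    using Cons.IH ratio[of i] word_ratio_pos[of w] by (simp add: mult_le_one)
qed simp

lemma word_ratio_less_1: "w \<in> words N \<Longrightarrow> word_ratio r w < 1"
proof (cases w)
  case (Cons i v)
  assume w: "w \<in> words N"
  then have "r i * word_ratio r v \<le> r i * 1"
    using Cons by (intro mult_left_mono word_ratio_le_1 less_imp_le[OF ratio(1)]) (auto simp: words_def)
  moreover have "r i < 1"
    using Cons w by (intro ratio) (auto simp: words_def)
  ultimately show ?thesis
    using Cons by simp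
qed (auto simp: words_def)

lemma word_map_dist:
  "set w \<subseteq> letters \<Longrightarrow> dist (word_map S w x) (word_map S w y) = word_ratio r w * dist x y"
  by (induction w) (auto simp: S_dist simp del: atLeastAtMost_iff)

lemma word_map_bij: "set w \<subseteq> letters \<Longrightarrow> bij (word_map S w)"
  by (rule similarity_bij[OF word_ratio_pos word_map_dist])

lemma word_map_in_F: "set w \<subseteq> letters \<Longrightarrow> x \<in> F \<Longrightarrow> word_map S w x \<in> F"
  by (induction w) (auto simp: S_in_F simp del: atLeastAtMost_iff)

lemma words_letters: "w \<in> words N \<Longrightarrow> set w \<subseteq> letters"
  and words_hd: "w \<in> words N \<Longrightarrow> hd w \<in> letters"
  and words_append: "v \<in> words N \<Longrightarrow> set w \<subseteq> letters \<Longrightarrow> v @ w \<in> words N"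
  and words_singleton: "i \<in> letters \<Longrightarrow> [i] \<in> words N"
  and words_not_Nil: "w \<in> words N \<Longrightarrow> w \<noteq> []"
  by (auto simp: words_def subset_iff)

lemma hd_append_words: "v \<in> words N \<Longrightarrow> hd (v @ w) = hd v"
  by (simp add: words_def)

text \<open>
  Stating membership in \<open>H\<close> by an equation between word maps avoids inverses altogether; all later arguments
  about neighbours use this form.
\<close>

lemma neighbor_union_iff:
  "q \<in> H \<longleftrightarrow> (\<exists>\<sigma>\<in>words N. \<exists>\<omega>\<in>words N. hd \<sigma> \<noteq> hd \<omega> \<and> (\<exists>a\<in>F. word_map S \<sigma> q = word_map S \<omega> a))"
proof -
  have "inv (word_map S \<sigma>) x = q \<longleftrightarrow> word_map S \<sigma> q = x" if "\<sigma> \<in> words N" for \<sigma> x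
    using word_map_bij[OF words_letters[OF that]] by (metis bij_inv_eq_iff)
  then show ?thesis
    unfolding neighbor_union_def neighbor_maps_def by (fastforce simp: image_iff)
qed

text \<open>
  Iterating \<open>F = (\<Union>i. S\<^sub>i F)\<close> shows that the cylinders of each fixed length cover \<open>F\<close>.
\<close>

lemma word_map_cover:
  assumes "y \<in> F"
  shows "\<exists>\<alpha> y'. length \<alpha> = n \<and> set \<alpha> \<subseteq> letters \<and> y' \<in> F \<and> y = word_map S \<alpha> y'"
proof (induction n)
  case 0
  then show ?case
    using assms by auto
next
  case (Suc n)
  then obtain \<alpha> y' where \<alpha>: "length \<alpha> = n" "set \<alpha> \<subseteq> letters" "y' \<in> F" "y = word_map S \<alpha> y'"
    by blast
  obtain i y'' where "i \<in> letters" "y'' \<in> F" "y' = S i y''"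
    by (rule F_cases[OF \<alpha>(3)])
  then show ?case
    using \<alpha> by (intro exI[of _ "\<alpha> @ [i]"] exI[of _ y'']) auto
qed

lemma word_ratio_le_power:
  obtains c where "0 \<le> c" "c < 1" "\<And>w. set w \<subseteq> letters \<Longrightarrow> word_ratio r w \<le> c ^ length w"
proof
  let ?c = "Max (r ` letters)"
  have fin: "finite (r ` letters)" "r ` letters \<noteq> {}"
    using two_letters by auto
  have le: "i \<in> letters \<Longrightarrow> r i \<le> ?c" for i
    by simp
  show "0 \<le> ?c"
    using le[OF two_letters(1)] ratio(1)[OF two_letters(1)] by linarith
  show "?c < 1"
    using fin ratio(2) by (subst Max_less_iff) auto
  show "word_ratio r w \<le> ?c ^ length w" if "set w \<subseteq> letters" for w
    using that
  proof (induction w)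
    case (Cons i w)
    then show ?case
      using le[of i] \<open>0 \<le> ?c\<close> word_ratio_pos[of w] by (auto intro!: mult_mono simp del: Max_less_iff)
  qed simp
qed

lemma small_cylinder_through:
  assumes "\<omega> \<in> words N" "a \<in> F" "0 < b"
  obtains \<omega>' a' where "\<omega>' \<in> words N" "hd \<omega>' = hd \<omega>" "a' \<in> F"
    "word_map S \<omega>' a' = word_map S \<omega> a" "word_ratio r \<omega>' \<le> b"
proof -
  obtain c where c: "0 \<le> c" "c < 1" "\<And>w. set w \<subseteq> letters \<Longrightarrow> word_ratio r w \<le> c ^ length w"
    using word_ratio_le_power by blast
  obtain n where n: "c ^ n < b"
    using real_arch_pow_inv[OF \<open>0 < b\<close> \<open>c < 1\<close>] by blast
  obtain \<alpha> a' where \<alpha>: "length \<alpha> = n" "set \<alpha> \<subseteq> letters" "a' \<in> F" "a = word_map S \<alpha> a'"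
    using word_map_cover[OF \<open>a \<in> F\<close>] by blast
  have "word_ratio r \<omega> * word_ratio r \<alpha> \<le> 1 * word_ratio r \<alpha>"
    using word_ratio_le_1[OF words_letters[OF assms(1)]] word_ratio_pos[OF \<alpha>(2)]
    by (intro mult_right_mono) auto
  also have "\<dots> \<le> b"
    using c(3)[OF \<alpha>(2)] n \<alpha>(1) by simp
  finally show thesis
    using \<alpha> assms(1) by (intro that[of "\<omega> @ \<alpha>" a']) (auto simp: words_append hd_append_words simp del: atLeastAtMost_iff)
qed

section \<open>A cylinder at positive distance from the neighbours\<close>

text \<open>
  The cutset of level \<open>b\<close> consists of the words whose cylinders first reach size at most \<open>b\<close>. For
  \<open>0 < b < 1\<close> every infinite sequence of letters has exactly one prefix in it.
\<close>

definition cutset :: "real \<Rightarrow> nat list set" where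
  "cutset b = {\<omega> \<in> words N. word_ratio r \<omega> \<le> b \<and> b < word_ratio r (butlast \<omega>)}"

text \<open>
  Closeness is measured in units of \<open>word_ratio r \<sigma>\<close>, so that the notion is invariant under
  prepending a common word.
\<close>

definition nearby :: "nat list \<Rightarrow> nat list set" where
  "nearby \<sigma> = {\<omega> \<in> cutset (word_ratio r \<sigma>).
     \<exists>x\<in>F. \<exists>y\<in>F. dist (word_map S \<sigma> x) (word_map S \<omega> y) < word_ratio r \<sigma>}"

text \<open>
  Refine \<open>\<omega>\<close> around the given point until its cylinder is small, then cut back to the shortest
  prefix that is small enough. The prefix may be shorter than \<open>\<omega>\<close>, but \<open>b < 1\<close> keeps it
  nonempty, so the first letter survives.
\<close>

lemma cutset_cylinder_through:
  assumes "\<omega> \<in> words N" "a \<in> F" "0 < b" "b < 1"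
  obtains \<omega>' a' where "\<omega>' \<in> cutset b" "hd \<omega>' = hd \<omega>" "a' \<in> F"
    "word_map S \<omega>' a' = word_map S \<omega> a"
proof -
  obtain \<omega>1 a1 where 1: "\<omega>1 \<in> words N" "hd \<omega>1 = hd \<omega>" "a1 \<in> F"
    "word_map S \<omega>1 a1 = word_map S \<omega> a" "word_ratio r \<omega>1 \<le> b"
    by (rule small_cylinder_through[OF assms(1-3)])
  define n where "n = (LEAST n. word_ratio r (take n \<omega>1) \<le> b)"
  have n: "word_ratio r (take n \<omega>1) \<le> b"
    unfolding n_def by (rule LeastI[of _ "length \<omega>1"]) (simp add: 1)
  have least: "b < word_ratio r (take m \<omega>1)" if "m < n" for m
    using not_less_Least[of m "\<lambda>n. word_ratio r (take n \<omega>1) \<le> b"] that unfolding n_def by linarith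
  have "n \<noteq> 0"
    using n \<open>b < 1\<close> by (cases n) auto
  have "n \<le> length \<omega>1"
    unfolding n_def by (rule Least_le) (simp add: 1)
  have sub: "set (take n \<omega>1) \<subseteq> letters" "set (drop n \<omega>1) \<subseteq> letters"
    by (rule subset_trans[OF set_take_subset words_letters[OF 1(1)]],
        rule subset_trans[OF set_drop_subset words_letters[OF 1(1)]])
  have "word_map S \<omega>1 a1 = word_map S (take n \<omega>1) (word_map S (drop n \<omega>1) a1)"
    by (metis append_take_drop_id word_map_append)
  moreover have "take n \<omega>1 \<in> cutset b"
    using n least[of "n - 1"] sub \<open>n \<noteq> 0\<close> \<open>n \<le> length \<omega>1\<close> words_not_Nil[OF 1(1)]
    by (auto simp: cutset_def words_def butlast_take)
  moreover have "hd (take n \<omega>1) = hd \<omega>"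
    using \<open>n \<noteq> 0\<close> 1(2) by simp
  ultimately show thesis
    using that word_map_in_F[OF sub(2) 1(3)] 1(4) by metis
qed

lemma cutset_parallel:
  assumes "\<omega> \<in> cutset b" "\<omega>' \<in> cutset b" "\<omega> \<noteq> \<omega>'"
  shows "\<omega> \<parallel> \<omega>'"
proof -
  have "False" if pre: "prefix v w" and vw: "v \<in> cutset b" "w \<in> cutset b" "v \<noteq> w" for v w
  proof -
    obtain u where u: "w = v @ u" "u \<noteq> []"
      using pre vw(3) by (auto elim: prefixE)
    have "set v \<subseteq> letters" "set (butlast u) \<subseteq> letters"
      using vw(2) u(1) by (auto simp: cutset_def words_def dest: in_set_butlastD)
    then have "word_ratio r (butlast w) \<le> word_ratio r v"
      using word_ratio_pos[of v] word_ratio_le_1[of "butlast u"] u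
      by (simp add: butlast_append mult_left_le)
    then show False
      using vw by (auto simp: cutset_def)
  qed
  then show ?thesis
    using assms by blast
qed

text \<open>
  Below the first letter in which two incomparable words differ, the images of \<open>U\<close> stay in \<open>U\<close>,
  and at that letter they are separated.
\<close>

lemma parallel_cylinders_disjoint:
  assumes O: "open_set_relations N S U"
    and "\<omega> \<in> words N" "\<omega>' \<in> words N" "\<omega> \<parallel> \<omega>'" "x \<in> U" "y \<in> U"
  shows "word_map S \<omega> x \<noteq> word_map S \<omega>' y"
proof
  assume eq: "word_map S \<omega> x = word_map S \<omega>' y"
  have in_U: "word_map S w z \<in> U" if "set w \<subseteq> letters" "z \<in> U" for w z
    using that O by (induction w) (auto simp: open_set_relations_def simp del: atLeastAtMost_iff)
  obtain v i u j w where dec: "i \<noteq> j" "\<omega> = v @ i # u" "\<omega>' = v @ j # w"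
    using parallel_decomp[OF assms(4)] by blast
  have sub: "set v \<subseteq> letters" "i \<in> letters" "j \<in> letters" "set u \<subseteq> letters" "set w \<subseteq> letters"
    using assms(2,3) dec by (auto simp: words_def)
  have "S i (word_map S u x) = S j (word_map S w y)"
    using eq bij_is_inj[OF word_map_bij[OF sub(1)]] by (simp add: dec inj_eq)
  then have "S i ` U \<inter> S j ` U \<noteq> {}"
    using in_U[OF sub(4) \<open>x \<in> U\<close>] in_U[OF sub(5) \<open>y \<in> U\<close>] by (metis IntI empty_iff imageI)
  then show False
    using O sub dec(1) unfolding open_set_relations_def by blast
qed

text \<open>
  Fix \<open>a\<close> with \<open>ball a \<rho> \<subseteq> U\<close>, where \<open>U\<close> is given by the open set condition. For the words near
  \<open>\<sigma>\<close> the balls \<open>S\<^sub>\<omega> (ball a \<rho>)\<close> are disjoint and have radius comparable to \<open>b = word_ratio r \<sigma>\<close>. Rescaled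
  by \<open>1 / b\<close>, their centres form a separated family in a ball that does not depend on \<open>\<sigma>\<close>.
\<close>

lemma nearby_card_bounded:
  assumes "open_set_condition N S"
  obtains M where "\<And>\<sigma>. \<sigma> \<in> words N \<Longrightarrow> finite (nearby \<sigma>) \<and> card (nearby \<sigma>) \<le> M"
proof -
  obtain U where "bounded U" and U: "open_set_relations N S U"
    using assms by (auto simp: open_set_condition_def feasible_open_set_def)
  then obtain a where "a \<in> U" "open U"
    by (auto simp: open_set_relations_def)
  then obtain \<rho> where \<rho>: "0 < \<rho>" "ball a \<rho> \<subseteq> U"
    by (meson openE)
  define D where "D = diameter (insert a F)"
  have D: "dist a x \<le> D" if "x \<in> F" for x
    unfolding D_def using F_compact that by (intro diameter_bounded_bound) (auto simp: compact_imp_bounded)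
  define m where "m = Min (r ` letters)"
  have m: "0 < m" "\<And>i. i \<in> letters \<Longrightarrow> m \<le> r i"
    unfolding m_def using ratio(1) two_letters by (subst Min_gr_iff) auto
  have "0 < m * \<rho>"
    using m(1) \<rho>(1) by simp
  obtain M where M: "\<forall>(I :: nat list set) (f :: nat list \<Rightarrow> real ^ 'd).
      f ` I \<subseteq> cball 0 (2 * D + 1) \<and> (\<forall>i\<in>I. \<forall>j\<in>I. i \<noteq> j \<longrightarrow> m * \<rho> \<le> dist (f i) (f j))
        \<longrightarrow> finite I \<and> card I \<le> M"
    using bounded_separated_card_le[OF bounded_cball \<open>0 < m * \<rho>\<close>] by metis
  show thesis
  proof (rule that)
    fix \<sigma> assume \<sigma>: "\<sigma> \<in> words N"
    define b where "b = word_ratio r \<sigma>"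
    have "0 < b"
      unfolding b_def by (intro word_ratio_pos words_letters \<sigma>)
    define f where "f \<omega> = (1 / b) *\<^sub>R (word_map S \<omega> a - word_map S \<sigma> a)" for \<omega>
    have f_dist: "dist (f \<omega>) (f \<omega>') = dist (word_map S \<omega> a) (word_map S \<omega>' a) / b" for \<omega> \<omega>'
      using \<open>0 < b\<close> by (simp add: f_def dist_norm flip: scaleR_diff_right)
    have \<omega>: "\<omega> \<in> words N" "set \<omega> \<subseteq> letters" "word_ratio r \<omega> \<le> b" "b * m \<le> word_ratio r \<omega>"
      if "\<omega> \<in> nearby \<sigma>" for \<omega>
    proof -
      show 1: "\<omega> \<in> words N" "word_ratio r \<omega> \<le> b"
        using that by (auto simp: nearby_def cutset_def b_def)
      then show 2: "set \<omega> \<subseteq> letters"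
        by (intro words_letters)
      have "\<omega> = butlast \<omega> @ [last \<omega>]"
        using words_not_Nil[OF 1(1)] by simp
      then have "word_ratio r \<omega> = word_ratio r (butlast \<omega>) * r (last \<omega>)"
        by (metis word_ratio_simps mult.right_neutral)
      moreover have "b \<le> word_ratio r (butlast \<omega>)"
        using that by (simp add: nearby_def cutset_def b_def)
      moreover have "m \<le> r (last \<omega>)"
        using m(2) 2 words_not_Nil[OF 1(1)] last_in_set by blast
      ultimately show "b * m \<le> word_ratio r \<omega>"
        using m(1) \<open>0 < b\<close> by (simp add: mult_mono)
    qed
    show "finite (nearby \<sigma>) \<and> card (nearby \<sigma>) \<le> M"
    proof (rule M[rule_format, of f], intro conjI ballI impI)
      show "f ` nearby \<sigma> \<subseteq> cball 0 (2 * D + 1)"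
      proof (rule image_subsetI)
        fix \<omega> assume *: "\<omega> \<in> nearby \<sigma>"
        then obtain x y where xy: "x \<in> F" "y \<in> F" "dist (word_map S \<sigma> x) (word_map S \<omega> y) < b"
          by (auto simp: nearby_def b_def)
        have "dist (word_map S \<sigma> a) (word_map S \<sigma> x) \<le> b * D"
          using word_map_dist[OF words_letters[OF \<sigma>]] D[OF xy(1)] \<open>0 < b\<close> by (simp add: b_def)
        moreover have "dist (word_map S \<omega> a) (word_map S \<omega> y) \<le> b * D"
          using word_map_dist[OF \<omega>(2)[OF *]] D[OF xy(2)] \<open>0 < b\<close> \<omega>(3)[OF *]
          by (simp add: mult_mono)
        moreover have "dist (word_map S \<omega> a) (word_map S \<sigma> a)
            \<le> dist (word_map S \<omega> a) (word_map S \<omega> y) + dist (word_map S \<sigma> x) (word_map S \<omega> y)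
              + dist (word_map S \<sigma> a) (word_map S \<sigma> x)"
          by metric
        ultimately have "dist (word_map S \<omega> a) (word_map S \<sigma> a) \<le> (2 * D + 1) * b"
          using xy(3) by (simp add: algebra_simps)
        then show "f \<omega> \<in> cball 0 (2 * D + 1)"
          using \<open>0 < b\<close> by (simp add: f_def flip: dist_norm) (simp add: pos_divide_le_eq)
      qed
    next
      fix \<omega> \<omega>' assume *: "\<omega> \<in> nearby \<sigma>" "\<omega>' \<in> nearby \<sigma>" "\<omega> \<noteq> \<omega>'"
      have par: "\<omega> \<parallel> \<omega>'"
        using * by (intro cutset_parallel[of _ b]) (auto simp: nearby_def b_def)
      obtain x where x: "word_map S \<omega> x = word_map S \<omega>' a"
        using bij_is_surj[OF word_map_bij[OF \<omega>(2)[OF *(1)]]] by (metis surjD)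
      have "x \<notin> U"
        using parallel_cylinders_disjoint[OF U \<omega>(1)[OF *(1)] \<omega>(1)[OF *(2)] par _ \<open>a \<in> U\<close>] x by blast
      then have "\<rho> \<le> dist a x"
        using \<rho>(2) by (meson mem_ball not_less subsetD)
      then have "(b * m) * \<rho> \<le> word_ratio r \<omega> * dist a x"
        using \<omega>(4)[OF *(1)] m(1) \<open>0 < b\<close> \<rho>(1) word_ratio_pos[OF \<omega>(2)[OF *(1)]]
        by (intro mult_mono) auto
      also have "\<dots> = dist (word_map S \<omega> a) (word_map S \<omega>' a)"
        using word_map_dist[OF \<omega>(2)[OF *(1)], of a x] x by simp
      finally show "m * \<rho> \<le> dist (f \<omega>) (f \<omega>')"
        using \<open>0 < b\<close> by (simp add: f_dist pos_le_divide_eq mult_ac)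
    qed
  qed
qed

lemma nearby_append:
  assumes "\<tau> \<in> words N" "\<omega> \<in> nearby \<sigma>"
  shows "\<tau> @ \<omega> \<in> nearby (\<tau> @ \<sigma>)"
proof -
  obtain x y where xy: "x \<in> F" "y \<in> F" "dist (word_map S \<sigma> x) (word_map S \<omega> y) < word_ratio r \<sigma>"
    and \<omega>: "\<omega> \<in> words N" "word_ratio r \<omega> \<le> word_ratio r \<sigma>" "word_ratio r \<sigma> < word_ratio r (butlast \<omega>)"
    using assms(2) by (auto simp: nearby_def cutset_def)
  have \<tau>: "set \<tau> \<subseteq> letters" "0 < word_ratio r \<tau>"
    by (intro word_ratio_pos words_letters assms)+
  have "\<tau> @ \<omega> \<in> cutset (word_ratio r (\<tau> @ \<sigma>))"
    using \<omega> \<tau>(2) words_not_Nil[OF \<omega>(1)] words_append[OF assms(1) words_letters[OF \<omega>(1)]]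
    by (simp add: cutset_def butlast_append)
  moreover have "dist (word_map S (\<tau> @ \<sigma>) x) (word_map S (\<tau> @ \<omega>) y) < word_ratio r (\<tau> @ \<sigma>)"
    using xy(3) \<tau>(2) by (simp add: word_map_dist[OF \<tau>(1)])
  ultimately show ?thesis
    using xy(1,2) unfolding nearby_def by blast
qed

text \<open>
  For \<open>\<sigma>\<close> with the largest number of nearby words, the words near \<open>\<tau> @ \<sigma>\<close> are exactly \<open>\<tau> @ \<omega>\<close>
  with \<open>\<omega>\<close> near \<open>\<sigma>\<close>; in particular they all begin like \<open>\<tau>\<close>. A neighbour \<open>S\<^sub>\<tau>\<inverse> S\<^sub>\<omega> F\<close> closer than
  \<open>word_ratio r \<sigma>\<close> to \<open>S\<^sub>\<sigma> F\<close> would produce one that begins like \<open>\<omega>\<close>.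
\<close>

lemma cylinder_away_from_neighbors:
  assumes "open_set_condition N S"
  obtains \<sigma> where "\<sigma> \<in> words N"
    "\<And>x q. x \<in> F \<Longrightarrow> q \<in> H \<Longrightarrow> word_ratio r \<sigma> \<le> dist (word_map S \<sigma> x) q"
proof -
  obtain M where M: "\<And>\<sigma>. \<sigma> \<in> words N \<Longrightarrow> finite (nearby \<sigma>) \<and> card (nearby \<sigma>) \<le> M"
    using nearby_card_bounded[OF assms] by blast
  have "\<exists>\<sigma>. \<sigma> \<in> words N \<and> (\<forall>\<tau>. \<tau> \<in> words N \<longrightarrow> card (nearby \<tau>) \<le> card (nearby \<sigma>))"
    using M words_singleton[OF two_letters(1)]
    by (intro ex_has_greatest_nat[of _ "[1]" _ "Suc M"]) (auto simp: less_Suc_eq_le)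
  then obtain \<sigma> where \<sigma>: "\<sigma> \<in> words N"
    and max: "\<And>\<tau>. \<tau> \<in> words N \<Longrightarrow> card (nearby \<tau>) \<le> card (nearby \<sigma>)"
    by blast
  have eq: "nearby (\<tau> @ \<sigma>) = (@) \<tau> ` nearby \<sigma>" if \<tau>: "\<tau> \<in> words N" for \<tau>
  proof (rule sym, rule card_seteq)
    have \<tau>\<sigma>: "\<tau> @ \<sigma> \<in> words N"
      by (intro words_append words_letters \<tau> \<sigma>)
    then show "finite (nearby (\<tau> @ \<sigma>))"
      using M by blast
    show "(@) \<tau> ` nearby \<sigma> \<subseteq> nearby (\<tau> @ \<sigma>)"
      using nearby_append[OF \<tau>] by blast
    show "card (nearby (\<tau> @ \<sigma>)) \<le> card ((@) \<tau> ` nearby \<sigma>)"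
      using max[OF \<tau>\<sigma>] by (simp add: card_image inj_on_def)
  qed
  show thesis
  proof (rule that[OF \<sigma>], rule ccontr)
    fix x q assume "x \<in> F" "q \<in> H" and close: "\<not> word_ratio r \<sigma> \<le> dist (word_map S \<sigma> x) q"
    then obtain \<tau> \<omega> a where h: "\<tau> \<in> words N" "\<omega> \<in> words N" "hd \<tau> \<noteq> hd \<omega>" "a \<in> F"
      "word_map S \<tau> q = word_map S \<omega> a"
      unfolding neighbor_union_iff by blast
    have \<tau>\<sigma>: "\<tau> @ \<sigma> \<in> words N"
      by (intro words_append words_letters h \<sigma>)
    obtain \<omega>' a' where \<omega>': "\<omega>' \<in> cutset (word_ratio r (\<tau> @ \<sigma>))" "hd \<omega>' = hd \<omega>" "a' \<in> F"
      "word_map S \<omega>' a' = word_map S \<omega> a"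
      using cutset_cylinder_through[OF h(2,4)] word_ratio_pos[OF words_letters[OF \<tau>\<sigma>]]
        word_ratio_less_1[OF \<tau>\<sigma>] by metis
    have "dist (word_map S (\<tau> @ \<sigma>) x) (word_map S \<omega>' a') = word_ratio r \<tau> * dist (word_map S \<sigma> x) q"
      using word_map_dist[OF words_letters[OF h(1)]] by (simp add: \<omega>'(4) flip: h(5))
    also have "\<dots> < word_ratio r (\<tau> @ \<sigma>)"
      using close word_ratio_pos[OF words_letters[OF h(1)]] by simp
    finally have "\<omega>' \<in> nearby (\<tau> @ \<sigma>)"
      using \<omega>'(1,3) \<open>x \<in> F\<close> unfolding nearby_def by blast
    then have "hd \<omega>' = hd \<tau>"
      using hd_append_words[OF h(1)] by (auto simp: eq[OF h(1)])
    then show False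
      using \<omega>'(2) h(3) by simp
  qed
qed

section \<open>The central open set\<close>

lemma neighbor_preimage:
  assumes "i \<in> letters" "j \<in> letters" "i \<noteq> j" "y \<in> F" "S i q = S j y"
  shows "q \<in> H"
proof -
  have "hd [i] \<noteq> hd [j]" "word_map S [i] q = word_map S [j] y"
    using assms(3,5) by simp_all
  then show ?thesis
    unfolding neighbor_union_iff using words_singleton[OF assms(1)] words_singleton[OF assms(2)] assms(4)
    by blast
qed

lemma H_backward_invariant:
  assumes "i \<in> letters" "S i q \<in> H"
  shows "q \<in> H"
proof -
  obtain \<sigma> \<omega> a where h: "\<sigma> \<in> words N" "\<omega> \<in> words N" "hd \<sigma> \<noteq> hd \<omega>" "a \<in> F"
    "word_map S \<sigma> (S i q) = word_map S \<omega> a"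
    using assms(2) unfolding neighbor_union_iff by blast
  have "\<sigma> @ [i] \<in> words N"
    using assms(1) by (intro words_append h) simp
  moreover have "hd (\<sigma> @ [i]) \<noteq> hd \<omega>" "word_map S (\<sigma> @ [i]) q = word_map S \<omega> a"
    using h by (simp_all add: hd_append_words)
  ultimately show ?thesis
    unfolding neighbor_union_iff using h(2,4) by blast
qed

lemma S_surj:
  assumes "i \<in> letters"
  obtains x where "S i x = y"
  using bij_is_surj[OF similarity_bij[OF ratio(1)[OF assms] S_dist[OF assms]]] by (metis surjD)

lemma H_nonempty: "H \<noteq> {}"
proof -
  obtain y where y: "y \<in> F"
    using F_nonempty by blast
  obtain q where "S 1 q = S 2 y"
    by (rule S_surj[OF two_letters(1)])
  then show ?thesis
    using neighbor_preimage[OF two_letters _ y] by auto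
qed

lemma F_nearest:
  obtains p where "p \<in> F" "infdist x F = dist x p" "\<And>y. y \<in> F \<Longrightarrow> dist x p \<le> dist x y"
proof -
  obtain p where "p \<in> F" "infdist x F = dist x p"
    using infdist_attains_inf[OF compact_imp_closed[OF F_compact] F_nonempty] by blast
  then show thesis
    using infdist_le[of _ F x] by (intro that[of p]) auto
qed

lemma V_open: "open V"
  unfolding central_open_set_def by (intro open_Collect_less continuous_intros)

lemma V_forward_invariant:
  assumes i: "i \<in> letters" and x: "x \<in> V"
  shows "S i x \<in> V"
proof -
  obtain p where p: "p \<in> F" "infdist x F = dist x p"
    by (rule F_nearest)
  have "infdist (S i x) F \<le> dist (S i x) (S i p)"
    by (intro infdist_le S_in_F i p)
  also have "\<dots> = r i * infdist x F"
    by (simp only: S_dist[OF i] p(2))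
  also have "\<dots> < r i * infdist x H"
    using x ratio(1)[OF i] by (simp add: central_open_set_def)
  also have "\<dots> \<le> infdist (S i x) H"
  proof (rule infdist_greatest[OF H_nonempty])
    fix q assume "q \<in> H"
    obtain q' where q': "S i q' = q"
      by (rule S_surj[OF i])
    then have "infdist x H \<le> dist x q'"
      using H_backward_invariant[OF i] \<open>q \<in> H\<close> by (intro infdist_le) simp
    then show "r i * infdist x H \<le> dist (S i x) q"
      using ratio(1)[OF i] by (simp add: S_dist[OF i] flip: q')
  qed
  finally show ?thesis
    by (simp add: central_open_set_def)
qed

text \<open>
  Since \<open>S\<^sub>i\<inverse> S\<^sub>j F \<subseteq> H\<close>, a point of \<open>F\<close> nearest to \<open>x \<in> V\<close> is strictly nearer to \<open>x\<close> than
  \<open>S\<^sub>i\<inverse> S\<^sub>j F\<close>; apply \<open>S\<^sub>i\<close>.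
\<close>

lemma V_image_nearest_piece:
  assumes i: "i \<in> letters" and x: "x \<in> V"
  obtains p where "p \<in> F"
    "\<And>j y. j \<in> letters \<Longrightarrow> j \<noteq> i \<Longrightarrow> y \<in> F \<Longrightarrow> dist (S i x) (S i p) < dist (S i x) (S j y)"
proof -
  obtain p where p: "p \<in> F" "infdist x F = dist x p"
    by (rule F_nearest)
  show thesis
  proof (rule that[OF p(1)])
    fix j y assume j: "j \<in> letters" "j \<noteq> i" and y: "y \<in> F"
    obtain q where q: "S i q = S j y"
      by (rule S_surj[OF i])
    have "dist x p < infdist x H"
      using x p(2) by (simp add: central_open_set_def)
    also have "\<dots> \<le> dist x q"
      using neighbor_preimage[OF i j(1) _ y q] j(2) by (intro infdist_le) auto
    finally show "dist (S i x) (S i p) < dist (S i x) (S j y)"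
      using ratio(1)[OF i] by (simp add: S_dist[OF i] flip: q)
  qed
qed

lemma V_images_disjoint:
  assumes "i \<in> letters" "j \<in> letters" "i \<noteq> j"
  shows "S i ` V \<inter> S j ` V = {}"
proof -
  have False if "x \<in> V" "y \<in> V" and eq: "S i x = S j y" for x y
  proof -
    obtain p where p: "p \<in> F"
      "\<And>k z. k \<in> letters \<Longrightarrow> k \<noteq> i \<Longrightarrow> z \<in> F \<Longrightarrow> dist (S i x) (S i p) < dist (S i x) (S k z)"
      using V_image_nearest_piece[OF assms(1) \<open>x \<in> V\<close>] by blast
    obtain q where q: "q \<in> F"
      "\<And>k z. k \<in> letters \<Longrightarrow> k \<noteq> j \<Longrightarrow> z \<in> F \<Longrightarrow> dist (S j y) (S j q) < dist (S j y) (S k z)"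
      using V_image_nearest_piece[OF assms(2) \<open>y \<in> V\<close>] by blast
    show False
      using p(2)[OF assms(2) _ q(1)] q(2)[OF assms(1) _ p(1)] assms(3) eq by force
  qed
  then show ?thesis
    by blast
qed

lemma V_meets_F:
  assumes "open_set_condition N S"
  shows "V \<inter> F \<noteq> {}"
proof -
  obtain \<sigma> where \<sigma>: "\<sigma> \<in> words N"
    "\<And>x q. x \<in> F \<Longrightarrow> q \<in> H \<Longrightarrow> word_ratio r \<sigma> \<le> dist (word_map S \<sigma> x) q"
    using cylinder_away_from_neighbors[OF assms] by blast
  obtain x where x: "x \<in> F"
    using F_nonempty by blast
  have "0 < word_ratio r \<sigma>"
    by (intro word_ratio_pos words_letters \<sigma>)
  also have "\<dots> \<le> infdist (word_map S \<sigma> x) H"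
    by (intro infdist_greatest H_nonempty \<sigma> x)
  finally have "word_map S \<sigma> x \<in> V"
    using word_map_in_F[OF words_letters[OF \<sigma>(1)] x] by (simp add: central_open_set_def)
  then show ?thesis
    using word_map_in_F[OF words_letters[OF \<sigma>(1)] x] by blast
qed

lemma V_projection_condition: "projection_condition N S F V"
  unfolding projection_condition_def
proof (intro ballI image_subsetI)
  fix i x assume i: "i \<in> letters" and x: "x \<in> V"
  obtain p where p: "p \<in> F"
    "\<And>j y. j \<in> letters \<Longrightarrow> j \<noteq> i \<Longrightarrow> y \<in> F \<Longrightarrow> dist (S i x) (S i p) < dist (S i x) (S j y)"
    using V_image_nearest_piece[OF i x] by blast
  obtain q where q: "q \<in> F" "\<And>y. y \<in> F \<Longrightarrow> dist (S i x) q \<le> dist (S i x) y"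
    using F_nearest[of "S i x"] by blast
  obtain j y where jy: "j \<in> letters" "y \<in> F" "q = S j y"
    by (rule F_cases[OF q(1)])
  have "j = i"
    using p(2)[OF jy(1) _ jy(2)] q(2)[OF S_in_F[OF i p(1)]] jy(3) by fastforce
  then have "q \<in> S i ` F"
    using jy by blast
  then show "S i x \<in> closure (metric_proj_preimage F (S i ` F))"
    using nearest_point_in_closure_metric_proj_preimage[OF q(1) _ q(2)] by blast
qed

section \<open>Boundedness of the central open set\<close>

lemma word_map_fixed_point:
  assumes "\<sigma> \<in> words N"
  obtains p where "p \<in> F" "word_map S \<sigma> p = p"
proof -
  have "\<exists>!p\<in>F. word_map S \<sigma> p = p"
  proof (rule Banach_fix)
    show "complete F"
      using F_compact by (rule compact_imp_complete)
    show "0 \<le> word_ratio r \<sigma>"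
      by (intro less_imp_le word_ratio_pos words_letters assms)
    show "word_ratio r \<sigma> < 1"
      by (rule word_ratio_less_1[OF assms])
    show "word_map S \<sigma> ` F \<subseteq> F"
      using word_map_in_F[OF words_letters[OF assms]] by blast
  qed (auto simp: F_nonempty word_map_dist[OF words_letters[OF assms]])
  then show thesis
    using that by blast
qed

text \<open>
  \<open>\<sigma>\<^sup>n\<close> begins with the first letter of \<open>\<sigma>\<close>, hence not with \<open>j\<close>, so the whole backward orbit of
  \<open>S\<^sub>j a\<close> under \<open>S\<^sub>\<sigma>\<close> consists of points of \<open>H\<close>.
\<close>

lemma H_half_space_fixed_point:
  assumes half: "\<And>q. q \<in> H \<Longrightarrow> u \<bullet> q \<le> c"
    and \<sigma>: "\<sigma> \<in> words N" and fixp: "word_map S \<sigma> p = p"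
    and j: "j \<in> letters" "j \<noteq> hd \<sigma>" and a: "a \<in> F"
  shows "u \<bullet> S j a \<le> u \<bullet> p"
proof (rule backward_orbit_half_space[of "word_ratio r \<sigma>" "word_map S \<sigma>" _ _ _ c])
  fix n :: nat and w
  assume n: "1 \<le> n" and w: "(word_map S \<sigma> ^^ n) w = S j a"
  let ?\<tau> = "concat (replicate n \<sigma>)"
  have "?\<tau> \<in> words N" "hd ?\<tau> = hd \<sigma>"
    using \<sigma> n by (cases n; auto simp: words_def)+
  moreover have "word_map S ?\<tau> w = word_map S [j] a"
    using w by (simp add: word_map_concat_replicate)
  ultimately show "u \<bullet> w \<le> c"
    using words_singleton[OF j(1)] j(2) a
    by (intro half, unfold neighbor_union_iff) (metis list.sel(1))
qed (use \<sigma> fixp word_ratio_less_1 in \<open>auto intro!: word_ratio_pos word_map_dist words_letters\<close>)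

text \<open>
  The point \<open>S\<^sub>i b\<close> is approximated by fixed points of words that begin with \<open>i\<close>: it lies in
  arbitrarily small cylinders of such words, and each cylinder contains the fixed point of its word.
\<close>

lemma H_half_space_pieces:
  assumes half: "\<And>q. q \<in> H \<Longrightarrow> u \<bullet> q \<le> c"
    and ij: "i \<in> letters" "j \<in> letters" "i \<noteq> j" and ab: "a \<in> F" "b \<in> F"
  shows "u \<bullet> S j a \<le> u \<bullet> S i b"
proof (rule field_le_epsilon)
  fix e :: real assume "0 < e"
  \<comment> \<open>The summand 1 keeps \<open>D\<close> positive when \<open>u = 0\<close> or \<open>F\<close> is a single point.\<close>
  define D where "D = 1 + norm u * diameter F"
  have "1 \<le> D"
    using F_compact by (simp add: D_def diameter_ge_0 compact_imp_bounded)
  then have "0 < e / D"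
    using \<open>0 < e\<close> by simp
  obtain \<sigma> b' where \<sigma>: "\<sigma> \<in> words N" "hd \<sigma> = i" "b' \<in> F" "word_map S \<sigma> b' = S i b"
    "word_ratio r \<sigma> \<le> e / D"
    using small_cylinder_through[OF words_singleton[OF ij(1)] ab(2) \<open>0 < e / D\<close>] by auto
  obtain p where p: "p \<in> F" "word_map S \<sigma> p = p"
    by (rule word_map_fixed_point[OF \<sigma>(1)])
  have "u \<bullet> (p - S i b) \<le> norm u * dist (word_map S \<sigma> p) (word_map S \<sigma> b')"
    unfolding p(2) \<sigma>(4) dist_norm by (rule norm_cauchy_schwarz)
  also have "\<dots> = word_ratio r \<sigma> * (norm u * dist p b')"
    by (simp add: word_map_dist[OF words_letters[OF \<sigma>(1)]])
  also have "\<dots> \<le> e / D * D"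
  proof (intro mult_mono \<sigma>)
    have "norm u * dist p b' \<le> norm u * diameter F"
      using F_compact p(1) \<sigma>(3)
      by (intro mult_left_mono diameter_bounded_bound) (auto simp: compact_imp_bounded)
    then show "norm u * dist p b' \<le> D"
      by (simp add: D_def)
  qed (use \<open>0 < e / D\<close> in auto)
  finally have "u \<bullet> p \<le> u \<bullet> S i b + e"
    using \<open>1 \<le> D\<close> by (simp add: inner_diff_right)
  moreover have "u \<bullet> S j a \<le> u \<bullet> p"
    using ij(3) by (intro H_half_space_fixed_point[OF half \<sigma>(1) p(2)] ij ab) (auto simp: \<sigma>(2))
  ultimately show "u \<bullet> S j a \<le> u \<bullet> S i b + e"
    by simp
qed

text \<open>
  Exchanging the roles of two different pieces turns the inequality into equality. Two points of the
  same piece are compared through a point of another piece.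
\<close>

lemma H_half_space_F_hyperplane:
  assumes half: "\<And>q. q \<in> H \<Longrightarrow> u \<bullet> q \<le> c" and "x \<in> F" "y \<in> F"
  shows "u \<bullet> x = u \<bullet> y"
proof -
  have eq: "u \<bullet> S j a = u \<bullet> S i b"
    if "i \<in> letters" "j \<in> letters" "i \<noteq> j" "a \<in> F" "b \<in> F" for i j a b
    using that by (intro antisym H_half_space_pieces[OF half]) auto
  obtain i a where ia: "i \<in> letters" "a \<in> F" "x = S i a"
    by (rule F_cases[OF \<open>x \<in> F\<close>])
  obtain j b where jb: "j \<in> letters" "b \<in> F" "y = S j b"
    by (rule F_cases[OF \<open>y \<in> F\<close>])
  obtain k where k: "k \<in> letters" "k \<noteq> i"
    by (rule other_letter)
  show ?thesis
  proof (cases "i = j")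
    case True
    then show ?thesis
      using eq[OF ia(1) k(1) _ ia(2,2)] eq[OF ia(1) k(1) _ ia(2) jb(2)] k(2) ia(3) jb(3) by simp
  next
    case False
    then show ?thesis
      using eq[OF jb(1) ia(1) _ ia(2) jb(2)] ia(3) jb(3) by simp
  qed
qed

text \<open>
  If \<open>x \<in> V\<close> has nearest point \<open>p \<in> F\<close> and \<open>q \<in> H\<close>, expanding \<open>dist x p < dist x q\<close> gives
  \<open>2 (x \<bullet> q) < 2 (x \<bullet> p) + (norm q)\<^sup>2\<close>. Divide by \<open>norm x\<close> and let \<open>x\<close> tend to infinity: the limit direction
  of \<open>x\<close> is bounded on \<open>H\<close> by the radius of \<open>F\<close>.
\<close>

lemma V_unbounded_H_half_space:
  assumes "\<not> bounded V"
  obtains u c where "u \<noteq> 0" "\<And>q. q \<in> H \<Longrightarrow> u \<bullet> q \<le> c"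
proof -
  obtain M where M: "\<And>x. x \<in> F \<Longrightarrow> norm x \<le> M"
    using compact_imp_bounded[OF F_compact] by (auto simp: bounded_iff)
  have "\<exists>x\<in>V. real (Suc n) < norm x" for n
    using assms unfolding bounded_iff by (meson not_less)
  then obtain x where x: "\<And>n. x n \<in> V" "\<And>n. real (Suc n) < norm (x n)"
    by metis
  have x_pos: "0 < norm (x n)" for n
    using x(2)[of n] by linarith
  define u where "u n = x n /\<^sub>R norm (x n)" for n
  have "u n \<in> sphere 0 1" for n
    using x_pos[of n] by (simp add: u_def)
  then obtain l s where l: "l \<in> sphere 0 1" "strict_mono (s :: nat \<Rightarrow> nat)" "(u \<circ> s) \<longlonglongrightarrow> l"
    using compact_sphere[of "0 :: real ^ 'd" 1] unfolding compact_def by metis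
  show thesis
  proof (rule that[of l M])
    show "l \<noteq> 0"
      using l(1) by auto
    fix q assume q: "q \<in> H"
    have bound: "u n \<bullet> q \<le> M + (norm q)\<^sup>2 * (1 / real (Suc n))" for n
    proof -
      obtain p where p: "p \<in> F" "infdist (x n) F = dist (x n) p"
        by (rule F_nearest)
      have "dist (x n) p < dist (x n) q"
        using x(1)[of n] infdist_le[OF q, of "x n"] by (simp add: central_open_set_def p(2))
      then have "(dist (x n) p)\<^sup>2 \<le> (dist (x n) q)\<^sup>2"
        by (intro power_mono) auto
      then have "2 * (x n \<bullet> q) \<le> 2 * (x n \<bullet> p) + q \<bullet> q - p \<bullet> p"
        by (simp add: dist_norm power2_norm_eq_inner algebra_simps inner_commute)
      also have "\<dots> \<le> 2 * (x n \<bullet> p) + 2 * (norm q)\<^sup>2"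
        by (simp add: power2_norm_eq_inner) (smt (verit) inner_ge_zero)
      also have "x n \<bullet> p \<le> norm (x n) * M"
        by (intro order.trans[OF norm_cauchy_schwarz] mult_left_mono M p) simp
      finally have "(x n \<bullet> q) / norm (x n) \<le> (norm (x n) * M + (norm q)\<^sup>2) / norm (x n)"
        by (intro divide_right_mono) auto
      also have "\<dots> = M + (norm q)\<^sup>2 * (1 / norm (x n))"
        using x_pos[of n] by (simp add: add_divide_distrib)
      also have "\<dots> \<le> M + (norm q)\<^sup>2 * (1 / real (Suc n))"
        using x(2)[of n] by (intro add_left_mono mult_left_mono divide_left_mono mult_pos_pos x_pos) auto
      finally show ?thesis
        by (simp add: u_def divide_inverse mult.commute)
    qed
    have "(\<lambda>n. M + (norm q)\<^sup>2 * (1 / real (Suc (s n)))) \<longlonglongrightarrow> M + (norm q)\<^sup>2 * 0"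
      using LIMSEQ_subseq_LIMSEQ[OF LIMSEQ_Suc[OF lim_1_over_n] l(2)]
      by (intro tendsto_intros) (simp add: comp_def)
    moreover have "(\<lambda>n. (u \<circ> s) n \<bullet> q) \<longlonglongrightarrow> l \<bullet> q"
      by (intro tendsto_intros l)
    ultimately show "l \<bullet> q \<le> M"
      using bound by (intro LIMSEQ_le[of _ _ "\<lambda>n. M + (norm q)\<^sup>2 * (1 / real (Suc (s n)))"]) auto
  qed
qed

lemma V_bounded:
  assumes "affine hull F = UNIV"
  shows "bounded V"
proof (rule ccontr)
  assume "\<not> bounded V"
  then obtain u c where u: "u \<noteq> 0" "\<And>q. q \<in> H \<Longrightarrow> u \<bullet> q \<le> c"
    using V_unbounded_H_half_space by blast
  obtain x where x: "x \<in> F"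
    using F_nonempty by blast
  have "affine hull F \<subseteq> {y. u \<bullet> y = u \<bullet> x}"
    using H_half_space_F_hyperplane[OF u(2) _ x] by (intro hull_minimal affine_hyperplane) blast
  then have "u \<bullet> (x + u) = u \<bullet> x"
    using assms by blast
  then show False
    using u(1) by (simp add: inner_add_right)
qed

end

theorem proposition3p16:
  fixes S :: "nat \<Rightarrow> real ^ 'd \<Rightarrow> real ^ 'd"
    and r :: "nat \<Rightarrow> real"
    and N :: nat
    and F :: "(real ^ 'd) set"
  assumes "ifs N r S"
    and "self_similar_set N S F"
    and "open_set_condition N S"
  shows "(affine hull F = UNIV \<longrightarrow> strong_feasible_open_set N S F (central_open_set N S F)) \<and>
         open_set_relations N S (central_open_set N S F) \<and>
         central_open_set N S F \<inter> F \<noteq> {} \<and>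
         projection_condition N S F (central_open_set N S F)"
proof -
  interpret self_similar_ifs N r S F
    using assms(1,2) by unfold_locales
  have meets: "V \<inter> F \<noteq> {}"
    by (rule V_meets_F[OF assms(3)])
  have relations: "open_set_relations N S V"
    unfolding open_set_relations_def
    using meets V_open V_forward_invariant V_images_disjoint by blast
  show ?thesis
    using meets relations V_bounded V_projection_condition
    unfolding strong_feasible_open_set_def feasible_open_set_def by blast
qed

end
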